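(* Let $n\ge1$. Whenever the variables satisfy $u_1=x_{11}y_{11}$, $u_3=x_{12}y_{12}$, $v_1=x_2+y_2$ and $u_2v_2=x_{12}y_{12}x_2+x_{11}y_{11}y_2$, one has $$G_{n+1}(x_{11},x_{12},x_2;y_{11},y_{12},y_2)=M_n(u_1,u_2,u_3;v_1,v_2).$$
   Context: A plane tree is an unlabeled rooted tree in which the children of every vertex are linearly ordered from left to right; $\mathcal P_n$ is the set of plane trees with $n$ edges. A leaf is a vertex with no children, an interior vertex one with at least one child. In a plane tree: a leaf without siblings is a singleton leaf; a leaf with siblings is an elder leaf if it is the leftmost child of its parent, and a young leaf otherwise; an interior vertex is a young interior vertex if it is not the parent of a singleton leaf or of an elder leaf. For $T\in\mathcal P_n$ let $\mathrm{sleaf},\mathrm{eleaf},\mathrm{yleaf}$ count singleton, elder, young leaves, $\mathrm{sint},\mathrm{eint}$ count parents of singleton leaves and parents of elder leaves, $\mathrm{yint}$ counts young interior vertices. For $n\ge2$, $G_n(x_{11},x_{12},x_2;y_{11},y_{12},y_2)=\sum_{T\in\mathcal P_n}x_{11}^{\mathrm{sleaf}(T)}x_{12}^{\mathrm{eleaf}(T)}x_2^{\mathrm{yleaf}(T)}y_{11}^{\mathrm{sint}(T)}y_{12}^{\mathrm{eint}(T)}y_2^{\mathrm{yint}(T)}$. A tip-augmented plane tree is a plane tree in which the leftmost child of every interior vertex is a leaf; $\mathcal T_m$ is the set of those with $m$ edges. In such a tree: a leaf without siblings is a singleton leaf; a leaf with siblings that is the leftmost child is an elder twin leaf if the second child of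 its parent is a leaf and an elder non-twin leaf otherwise; a leaf with siblings that is the second child is a second leaf; a leaf with siblings that is neither first nor second child is a younger leaf; $\mathrm{sleaf},\mathrm{etleaf},\mathrm{entleaf},\mathrm{syleaf},\mathrm{yerleaf}$ count these. For $n\ge1$, $M_n(u_1,u_2,u_3;v_1,v_2)=\sum_{T\in\mathcal T_{n+1}}u_1^{\mathrm{sleaf}(T)}u_2^{\mathrm{etleaf}(T)}u_3^{\mathrm{entleaf}(T)}v_1^{\mathrm{yerleaf}(T)}v_2^{\mathrm{syleaf}(T)}$. *)

theory Defs
  imports Main
begin

datatype plane_tree = Node (children: "plane_tree list")

fun edges :: "plane_tree \<Rightarrow> nat" where
  "edges (Node ts) = (\<Sum>t\<leftarrow>ts. Suc (edges t))"

text \<open>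
  A vertex is addressed by the path of child indices leading to it from the root: the root is
  \<open>[]\<close>, and the children of \<open>v\<close> are, from left to right, \<open>v @ [0]\<close>, \<open>v @ [1]\<close>, and so on.
\<close>

fun is_vertex :: "plane_tree \<Rightarrow> nat list \<Rightarrow> bool" where
  "is_vertex T [] = True"
| "is_vertex T (i # v) = (i < length (children T) \<and> is_vertex (children T ! i) v)"

definition vertices :: "plane_tree \<Rightarrow> nat list set" where
  "vertices T = {v. is_vertex T v}"

definition interior :: "plane_tree \<Rightarrow> nat list \<Rightarrow> bool" where
  "interior T v \<longleftrightarrow> v \<in> vertices T \<and> (\<exists>i. v @ [i] \<in> vertices T)"

definition leaf :: "plane_tree \<Rightarrow> nat list \<Rightarrow> bool" where
  "leaf T v \<longleftrightarrow> v \<in> vertices T \<and> \<not> (\<exists>i. v @ [i] \<in> vertices T)"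

definition siblings :: "plane_tree \<Rightarrow> nat list \<Rightarrow> nat list set" where
  "siblings T v = {w \<in> vertices T. w \<noteq> v \<and> (\<exists>p i j. v = p @ [i] \<and> w = p @ [j])}"

definition singleton_leaf :: "plane_tree \<Rightarrow> nat list \<Rightarrow> bool" where
  "singleton_leaf T v \<longleftrightarrow> leaf T v \<and> siblings T v = {}"

text \<open>A vertex with siblings is not the root, so \<open>last v\<close> is its position among the children of
  its parent \<open>butlast v\<close>, counted from 0.\<close>

definition elder_leaf :: "plane_tree \<Rightarrow> nat list \<Rightarrow> bool" where
  "elder_leaf T v \<longleftrightarrow> leaf T v \<and> siblings T v \<noteq> {} \<and> last v = 0"

definition young_leaf :: "plane_tree \<Rightarrow> nat list \<Rightarrow> bool" where
  "young_leaf T v \<longleftrightarrow> leaf T v \<and> siblings T v \<noteq> {} \<and> last v \<noteq> 0"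

definition parent_of_singleton_leaf :: "plane_tree \<Rightarrow> nat list \<Rightarrow> bool" where
  "parent_of_singleton_leaf T v \<longleftrightarrow> (\<exists>i. singleton_leaf T (v @ [i]))"

definition parent_of_elder_leaf :: "plane_tree \<Rightarrow> nat list \<Rightarrow> bool" where
  "parent_of_elder_leaf T v \<longleftrightarrow> (\<exists>i. elder_leaf T (v @ [i]))"

definition young_interior :: "plane_tree \<Rightarrow> nat list \<Rightarrow> bool" where
  "young_interior T v \<longleftrightarrow>
     interior T v \<and> \<not> parent_of_singleton_leaf T v \<and> \<not> parent_of_elder_leaf T v"

definition sleaf :: "plane_tree \<Rightarrow> nat" where
  "sleaf T = card {v \<in> vertices T. singleton_leaf T v}"

definition eleaf :: "plane_tree \<Rightarrow> nat" where
  "eleaf T = card {v \<in> vertices T. elder_leaf T v}"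

definition yleaf :: "plane_tree \<Rightarrow> nat" where
  "yleaf T = card {v \<in> vertices T. young_leaf T v}"

definition sint :: "plane_tree \<Rightarrow> nat" where
  "sint T = card {v \<in> vertices T. parent_of_singleton_leaf T v}"

definition eint :: "plane_tree \<Rightarrow> nat" where
  "eint T = card {v \<in> vertices T. parent_of_elder_leaf T v}"

definition yint :: "plane_tree \<Rightarrow> nat" where
  "yint T = card {v \<in> vertices T. young_interior T v}"

definition plane_trees :: "nat \<Rightarrow> plane_tree set" where
  "plane_trees n = {T. edges T = n}"

definition G_poly :: "nat \<Rightarrow> 'a \<Rightarrow> 'a \<Rightarrow> 'a \<Rightarrow> 'a \<Rightarrow> 'a \<Rightarrow> 'a \<Rightarrow> 'a::comm_ring_1" where
  "G_poly n x11 x12 x2 y11 y12 y2 =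
     (\<Sum>T\<in>plane_trees n.
        x11 ^ sleaf T * x12 ^ eleaf T * x2 ^ yleaf T *
        y11 ^ sint T * y12 ^ eint T * y2 ^ yint T)"

definition tip_augmented :: "plane_tree \<Rightarrow> bool" where
  "tip_augmented T \<longleftrightarrow> (\<forall>v. interior T v \<longrightarrow> leaf T (v @ [0]))"

definition elder_twin_leaf :: "plane_tree \<Rightarrow> nat list \<Rightarrow> bool" where
  "elder_twin_leaf T v \<longleftrightarrow>
     leaf T v \<and> siblings T v \<noteq> {} \<and> last v = 0 \<and> leaf T (butlast v @ [1])"

definition elder_nontwin_leaf :: "plane_tree \<Rightarrow> nat list \<Rightarrow> bool" where
  "elder_nontwin_leaf T v \<longleftrightarrow>
     leaf T v \<and> siblings T v \<noteq> {} \<and> last v = 0 \<and> \<not> leaf T (butlast v @ [1])"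

definition second_leaf :: "plane_tree \<Rightarrow> nat list \<Rightarrow> bool" where
  "second_leaf T v \<longleftrightarrow> leaf T v \<and> siblings T v \<noteq> {} \<and> last v = 1"

definition younger_leaf :: "plane_tree \<Rightarrow> nat list \<Rightarrow> bool" where
  "younger_leaf T v \<longleftrightarrow> leaf T v \<and> siblings T v \<noteq> {} \<and> last v \<noteq> 0 \<and> last v \<noteq> 1"

definition etleaf :: "plane_tree \<Rightarrow> nat" where
  "etleaf T = card {v \<in> vertices T. elder_twin_leaf T v}"

definition entleaf :: "plane_tree \<Rightarrow> nat" where
  "entleaf T = card {v \<in> vertices T. elder_nontwin_leaf T v}"

definition syleaf :: "plane_tree \<Rightarrow> nat" where
  "syleaf T = card {v \<in> vertices T. second_leaf T v}"

definition yerleaf :: "plane_tree \<Rightarrow> nat" where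
  "yerleaf T = card {v \<in> vertices T. younger_leaf T v}"

definition tip_augmented_trees :: "nat \<Rightarrow> plane_tree set" where
  "tip_augmented_trees m = {T. tip_augmented T \<and> edges T = m}"

definition M_poly :: "nat \<Rightarrow> 'a \<Rightarrow> 'a \<Rightarrow> 'a \<Rightarrow> 'a \<Rightarrow> 'a \<Rightarrow> 'a::comm_ring_1" where
  "M_poly n u1 u2 u3 v1 v2 =
     (\<Sum>T\<in>tip_augmented_trees (n + 1).
        u1 ^ sleaf T * u2 ^ etleaf T * u3 ^ entleaf T * v1 ^ yerleaf T * v2 ^ syleaf T)"

text \<open>The sums over trees and the cardinalities above range over finite sets.\<close>

lemma finite_vertices: "finite (vertices T)"
proof (induction T)
  case (Node ts)
  have "vertices (Node ts) \<subseteq> insert [] (\<Union>i\<in>{..<length ts}. Cons i ` vertices (ts ! i))"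
  proof
    fix v assume "v \<in> vertices (Node ts)"
    then show "v \<in> insert [] (\<Union>i\<in>{..<length ts}. Cons i ` vertices (ts ! i))"
      by (cases v) (auto simp: vertices_def)
  qed
  moreover have "finite (\<Union>i\<in>{..<length ts}. Cons i ` vertices (ts ! i))"
    using Node by auto
  ultimately show ?case
    by (meson finite.insertI finite_subset)
qed

lemma finite_plane_trees: "finite (plane_trees n)"
proof -
  have "finite {T. edges T \<le> n}"
  proof (induction n)
    case 0
    have "{T. edges T \<le> 0} \<subseteq> {Node []}"
    proof
      fix T assume "T \<in> {T. edges T \<le> 0}"
      then show "T \<in> {Node []}" by (cases T, cases "children T") auto
    qed
    then show ?case by (rule finite_subset) simp
  next
    case (Suc n)
    have "{T. edges T \<le> Suc n} \<subseteq>
        Node ` {ts. set ts \<subseteq> {T. edges T \<le> n} \<and> length ts \<le> Suc n}"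
    proof
      fix T assume T: "T \<in> {T. edges T \<le> Suc n}"
      obtain ts where ts: "T = Node ts" by (cases T)
      have "length ts \<le> (\<Sum>t\<leftarrow>ts. Suc (edges t))"
        by (induction ts) auto
      then have "length ts \<le> Suc n"
        using T by (simp add: ts)
      moreover have "edges t \<le> n" if "t \<in> set ts" for t
      proof -
        have "Suc (edges t) \<le> (\<Sum>t\<leftarrow>ts. Suc (edges t))"
          using that by (intro member_le_sum_list) auto
        then have "Suc (edges t) \<le> Suc n"
          using T by (simp add: ts)
        then show ?thesis by simp
      qed
      ultimately show "T \<in> Node ` {ts. set ts \<subseteq> {T. edges T \<le> n} \<and> length ts \<le> Suc n}"
        unfolding ts by (intro imageI) auto
    qed
    then show ?case
      by (rule finite_subset) (intro finite_imageI finite_lists_length_le Suc)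
  qed
  then show ?thesis
    by (rule rev_finite_subset) (auto simp: plane_trees_def)
qed

lemma finite_tip_augmented_trees: "finite (tip_augmented_trees m)"
  by (rule finite_subset[OF _ finite_plane_trees[of m]])
     (auto simp: tip_augmented_trees_def plane_trees_def)

end

theory Submission
  imports Defs "HOL-Computational_Algebra.Formal_Power_Series"
begin

(* Let F and M be the generating functions, by number of edges, of the two weights over trees with
   at least one edge, and write a = x11 y11, b = x12 y12, x = x2, y = y2. Decomposing a tree at its
   root gives
     F = z a + z b (S - 1) + z y F S   with  S = 1 + z (x + F) S,
     M = z (a + z (u2 v2 + b M) S')    with  S' = 1 + z (x + y + M) S'.
   Eliminating S and S', and using u2 v2 = b x + a y, shows that both F and M solve
     F = z a + z^2 (b - a) x + z (x + y + z (b - a)) F + z F^2,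
   an equation with only one solution in formal power series. *)

section \<open>Statistics of a tree in terms of its root subtrees\<close>

lemma vertices_Node:
  "vertices (Node ts) = insert [] (\<Union>i<length ts. Cons i ` vertices (ts ! i))"
proof (intro set_eqI iffI)
  fix v assume "v \<in> vertices (Node ts)"
  then show "v \<in> insert [] (\<Union>i<length ts. Cons i ` vertices (ts ! i))"
    by (cases v) (auto simp: vertices_def)
qed (auto simp: vertices_def)

lemma Nil_in_vertices [simp]: "[] \<in> vertices T"
  by (simp add: vertices_def)

lemma Cons_in_vertices [simp]:
  "i # v \<in> vertices (Node ts) \<longleftrightarrow> i < length ts \<and> v \<in> vertices (ts ! i)"
  by (simp add: vertices_def)

lemma prod_vertices_Node:
  fixes f :: "nat list \<Rightarrow> 'a::comm_monoid_mult"
  shows "(\<Prod>v\<in>vertices (Node ts). f v) = f [] * (\<Prod>i<length ts. \<Prod>v\<in>vertices (ts ! i). f (i # v))"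
proof -
  have "(\<Prod>v\<in>vertices (Node ts). f v)
      = f [] * prod f (\<Union>i<length ts. Cons i ` vertices (ts ! i))"
    unfolding vertices_Node by (rule prod.insert) (auto simp: finite_vertices)
  also have "prod f (\<Union>i<length ts. Cons i ` vertices (ts ! i))
      = (\<Prod>i<length ts. prod f (Cons i ` vertices (ts ! i)))"
    by (rule prod.UNION_disjoint) (auto simp: finite_vertices)
  also have "\<dots> = (\<Prod>i<length ts. \<Prod>v\<in>vertices (ts ! i). f (i # v))"
    by (simp add: prod.reindex inj_on_def)
  finally show ?thesis .
qed

text \<open>Turns each statistic in an exponent into a product of local factors over vertices, so
  that a whole tree weight becomes one product over \<open>vertices T\<close>.\<close>

lemma power_card_filter:
  fixes x :: "'a::comm_monoid_mult"
  assumes "finite A"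
  shows "x ^ card {v \<in> A. P v} = (\<Prod>v\<in>A. if P v then x else 1)"
  using assms by (simp add: prod.inter_filter[symmetric])

section \<open>Kinds of vertices in a tree and in its root subtrees\<close>

lemma leaf_Cons: "i < length ts \<Longrightarrow> leaf (Node ts) (i # v) \<longleftrightarrow> leaf (ts ! i) v"
  by (simp add: leaf_def)

lemma leaf_Nil: "leaf T [] \<longleftrightarrow> T = Node []"
  by (cases T) (auto simp: leaf_def)

lemma interior_Cons: "i < length ts \<Longrightarrow> interior (Node ts) (i # v) \<longleftrightarrow> interior (ts ! i) v"
  by (simp add: interior_def)

lemma interior_Nil: "interior T [] \<longleftrightarrow> T \<noteq> Node []"
  by (cases T) (auto simp: interior_def)

lemma siblings_Cons:
  assumes "i < length ts" "v \<noteq> []"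
  shows "siblings (Node ts) (i # v) = Cons i ` siblings (ts ! i) v"
proof (intro set_eqI iffI)
  fix w assume "w \<in> siblings (Node ts) (i # v)"
  then obtain p k j where w: "w \<in> vertices (Node ts)" "w \<noteq> i # v"
    and p: "i # v = p @ [k]" "w = p @ [j]"
    by (auto simp: siblings_def)
  from p(1) assms(2) obtain q where "p = i # q" "v = q @ [k]"
    by (cases p) auto
  with w p show "w \<in> Cons i ` siblings (ts ! i) v"
    by (auto simp: siblings_def)
next
  fix w assume "w \<in> Cons i ` siblings (ts ! i) v"
  then obtain p k j where "w = i # p @ [j]" "v = p @ [k]" "p @ [j] \<in> vertices (ts ! i)" "j \<noteq> k"
    by (auto simp: siblings_def)
  then show "w \<in> siblings (Node ts) (i # v)"
    using assms(1) unfolding siblings_def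
    by (auto intro!: exI[of _ "i # p"])
qed

lemma siblings_single:
  assumes "i < length ts"
  shows "siblings (Node ts) [i] = {} \<longleftrightarrow> length ts = 1"
proof
  assume *: "siblings (Node ts) [i] = {}"
  \<comment> \<open>Testing two positions suffices: a missing sibling \<open>[0]\<close> forces
    \<open>i = 0\<close>, and then a missing sibling \<open>[1]\<close> forces a single
    child.\<close>
  have "[0] \<notin> siblings (Node ts) [i]" "[1] \<notin> siblings (Node ts) [i]"
    by (simp_all add: *)
  then have "i = 0" "i = 0 \<Longrightarrow> \<not> 1 < length ts"
    using assms by (auto simp: siblings_def)
  then show "length ts = 1"
    using assms by linarith
qed (use assms in \<open>auto simp: siblings_def\<close>)

text \<open>The kind of a leaf depends on its siblings and its position, and below the root of a
  subtree both are the same in the subtree. The case \<open>v = []\<close> is excluded because that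
  root may gain siblings in the larger tree.\<close>

lemma leaf_kinds_Cons:
  assumes "i < length ts" "v \<noteq> []"
  shows "singleton_leaf (Node ts) (i # v) \<longleftrightarrow> singleton_leaf (ts ! i) v"
    and "elder_leaf (Node ts) (i # v) \<longleftrightarrow> elder_leaf (ts ! i) v"
    and "young_leaf (Node ts) (i # v) \<longleftrightarrow> young_leaf (ts ! i) v"
    and "elder_twin_leaf (Node ts) (i # v) \<longleftrightarrow> elder_twin_leaf (ts ! i) v"
    and "elder_nontwin_leaf (Node ts) (i # v) \<longleftrightarrow> elder_nontwin_leaf (ts ! i) v"
    and "second_leaf (Node ts) (i # v) \<longleftrightarrow> second_leaf (ts ! i) v"
    and "younger_leaf (Node ts) (i # v) \<longleftrightarrow> younger_leaf (ts ! i) v"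
  using assms
  by (simp_all add: singleton_leaf_def elder_leaf_def young_leaf_def elder_twin_leaf_def
      elder_nontwin_leaf_def second_leaf_def younger_leaf_def leaf_Cons siblings_Cons)

lemma leaf_singleD: "leaf (Node ts) [i] \<Longrightarrow> i < length ts"
  by (simp add: leaf_def)

lemma leaf_single: "leaf (Node ts) [i] \<longleftrightarrow> i < length ts \<and> ts ! i = Node []"
  using leaf_singleD leaf_Cons leaf_Nil by blast

text \<open>In the two elder cases a first child that is not alone has a right neighbour, so
  \<open>ts ! 1\<close> is a genuine entry of the list.\<close>

lemma leaf_kinds_single:
  assumes "i < length ts"
  shows "singleton_leaf (Node ts) [i] \<longleftrightarrow> ts ! i = Node [] \<and> length ts = 1"
    and "elder_leaf (Node ts) [i] \<longleftrightarrow> ts ! i = Node [] \<and> length ts \<noteq> 1 \<and> i = 0"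
    and "young_leaf (Node ts) [i] \<longleftrightarrow> ts ! i = Node [] \<and> length ts \<noteq> 1 \<and> i \<noteq> 0"
    and "elder_twin_leaf (Node ts) [i] \<longleftrightarrow>
      ts ! i = Node [] \<and> length ts \<noteq> 1 \<and> i = 0 \<and> ts ! 1 = Node []"
    and "elder_nontwin_leaf (Node ts) [i] \<longleftrightarrow>
      ts ! i = Node [] \<and> length ts \<noteq> 1 \<and> i = 0 \<and> ts ! 1 \<noteq> Node []"
    and "second_leaf (Node ts) [i] \<longleftrightarrow> ts ! i = Node [] \<and> length ts \<noteq> 1 \<and> i = 1"
    and "younger_leaf (Node ts) [i] \<longleftrightarrow> ts ! i = Node [] \<and> length ts \<noteq> 1 \<and> i \<noteq> 0 \<and> i \<noteq> 1"
  using assms less_linear[of 1 "length ts"]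
  by (auto simp: singleton_leaf_def elder_leaf_def young_leaf_def elder_twin_leaf_def
      elder_nontwin_leaf_def second_leaf_def younger_leaf_def leaf_single siblings_single)

lemma leaf_kinds_leafD:
  "singleton_leaf T v \<Longrightarrow> leaf T v" "elder_leaf T v \<Longrightarrow> leaf T v" "young_leaf T v \<Longrightarrow> leaf T v"
  "elder_twin_leaf T v \<Longrightarrow> leaf T v" "elder_nontwin_leaf T v \<Longrightarrow> leaf T v"
  "second_leaf T v \<Longrightarrow> leaf T v" "younger_leaf T v \<Longrightarrow> leaf T v"
  by (simp_all add: singleton_leaf_def elder_leaf_def young_leaf_def elder_twin_leaf_def
      elder_nontwin_leaf_def second_leaf_def younger_leaf_def)

text \<open>Here \<open>v = []\<close> is allowed: the kind of an interior vertex is determined by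
  its children, whose addresses inside the subtree are never empty.\<close>

lemma interior_kinds_Cons:
  assumes "i < length ts"
  shows "parent_of_singleton_leaf (Node ts) (i # v) \<longleftrightarrow> parent_of_singleton_leaf (ts ! i) v"
    and "parent_of_elder_leaf (Node ts) (i # v) \<longleftrightarrow> parent_of_elder_leaf (ts ! i) v"
    and "young_interior (Node ts) (i # v) \<longleftrightarrow> young_interior (ts ! i) v"
  using assms
  by (simp_all add: young_interior_def parent_of_singleton_leaf_def parent_of_elder_leaf_def
      leaf_kinds_Cons interior_Cons)

lemma interior_kinds_Nil:
  shows "parent_of_singleton_leaf (Node ts) [] \<longleftrightarrow> ts = [Node []]"
    and "parent_of_elder_leaf (Node (t # ts)) [] \<longleftrightarrow> t = Node [] \<and> ts \<noteq> []"
proof -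
  show "parent_of_singleton_leaf (Node ts) [] \<longleftrightarrow> ts = [Node []]"
  proof
    assume "parent_of_singleton_leaf (Node ts) []"
    then obtain i where i: "singleton_leaf (Node ts) [i]"
      by (auto simp: parent_of_singleton_leaf_def)
    then have "i < length ts"
      using leaf_kinds_leafD(1) leaf_singleD by blast
    with i show "ts = [Node []]"
      by (auto simp: leaf_kinds_single length_Suc_conv)
  qed (auto simp: parent_of_singleton_leaf_def leaf_kinds_single intro!: exI[of _ 0])
  show "parent_of_elder_leaf (Node (t # ts)) [] \<longleftrightarrow> t = Node [] \<and> ts \<noteq> []"
  proof
    assume "parent_of_elder_leaf (Node (t # ts)) []"
    then obtain i where i: "elder_leaf (Node (t # ts)) [i]"
      by (auto simp: parent_of_elder_leaf_def)
    then have "i < length (t # ts)"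
      using leaf_kinds_leafD(2) leaf_singleD by blast
    with i show "t = Node [] \<and> ts \<noteq> []"
      by (auto simp: leaf_kinds_single)
  qed (auto simp: parent_of_elder_leaf_def leaf_kinds_single intro!: exI[of _ 0])
qed

lemma interior_kinds_leafD:
  assumes "leaf T v"
  shows "\<not> parent_of_singleton_leaf T v" "\<not> parent_of_elder_leaf T v" "\<not> young_interior T v"
  using assms
  by (auto simp: young_interior_def parent_of_singleton_leaf_def parent_of_elder_leaf_def
      leaf_def interior_def singleton_leaf_def elder_leaf_def)

text \<open>Only a root subtree that is a single vertex changes its contribution when it becomes a
  child, since its leaf kind depends on its place; every other subtree contributes its own full
  weight. Here \<open>g\<close> collects the factors of leaves and \<open>h\<close> those of
  interior vertices.\<close>

lemma prod_leaf_interior_Node: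
  fixes g h :: "plane_tree \<Rightarrow> nat list \<Rightarrow> 'a::comm_monoid_mult"
  assumes g_leaf: "\<And>T v. \<not> leaf T v \<Longrightarrow> g T v = 1"
    and g_Cons: "\<And>ts i v. i < length ts \<Longrightarrow> v \<noteq> [] \<Longrightarrow> g (Node ts) (i # v) = g (ts ! i) v"
    and h_leaf: "\<And>T v. leaf T v \<Longrightarrow> h T v = 1"
    and h_Cons: "\<And>ts i v. i < length ts \<Longrightarrow> h (Node ts) (i # v) = h (ts ! i) v"
    and "ts \<noteq> []"
  shows "(\<Prod>v\<in>vertices (Node ts). g (Node ts) v * h (Node ts) v) =
    h (Node ts) [] * (\<Prod>i<length ts. if ts ! i = Node [] then g (Node ts) [i]
      else \<Prod>v\<in>vertices (ts ! i). g (ts ! i) v * h (ts ! i) v)"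
proof -
  have "g (Node ts) [] = 1"
    using \<open>ts \<noteq> []\<close> by (intro g_leaf) (simp add: leaf_Nil)
  moreover have "(\<Prod>v\<in>vertices (ts ! i). g (Node ts) (i # v) * h (Node ts) (i # v)) =
      (if ts ! i = Node [] then g (Node ts) [i]
       else \<Prod>v\<in>vertices (ts ! i). g (ts ! i) v * h (ts ! i) v)" if i: "i < length ts" for i
  proof (cases "ts ! i = Node []")
    case True
    have "h (Node ts) [i] = 1"
      using i True by (intro h_leaf) (simp add: leaf_single)
    then show ?thesis
      using True by (simp add: vertices_Node)
  next
    case False
    \<comment> \<open>At \<open>v = []\<close> both sides are 1, because the root of this subtree is
      not a leaf.\<close>
    have "g (Node ts) (i # v) = g (ts ! i) v" for v
      using i False by (cases "v = []") (simp_all add: g_Cons g_leaf leaf_single leaf_Nil)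
    then show ?thesis
      using False i by (simp add: h_Cons)
  qed
  ultimately show ?thesis
    by (simp add: prod_vertices_Node)
qed

lemma prod_nth_eq_prod_list:
  "(\<Prod>i<length ts. f (ts ! i)) = prod_list (map f ts)"
  by (induction ts) (simp_all add: prod.lessThan_Suc_shift del: prod.lessThan_Suc)

section \<open>The two tree weights\<close>

text \<open>Isolates the edgeless tree, whose contribution as a child depends on its position. With
  \<open>c = 0\<close> it removes that tree from a series; with \<open>f = 0\<close> it singles that
  tree out.\<close>

definition leaf_or :: "'a \<Rightarrow> (plane_tree \<Rightarrow> 'a) \<Rightarrow> plane_tree \<Rightarrow> 'a" where
  "leaf_or c f T = (if T = Node [] then c else f T)"

text \<open>A forest is encoded as the children of a tree, so that \<open>plane_trees\<close> also
  grades forests, each member counting its edges plus one for the edge above it.\<close>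

definition forest_weight :: "(plane_tree \<Rightarrow> 'a::comm_monoid_mult) \<Rightarrow> plane_tree \<Rightarrow> 'a" where
  "forest_weight f T = prod_list (map f (children T))"

definition G_weight ::
    "'a \<Rightarrow> 'a \<Rightarrow> 'a \<Rightarrow> 'a \<Rightarrow> 'a \<Rightarrow> 'a \<Rightarrow> plane_tree \<Rightarrow> 'a::comm_ring_1" where
  "G_weight x11 x12 x2 y11 y12 y2 T =
     x11 ^ sleaf T * x12 ^ eleaf T * x2 ^ yleaf T *
     y11 ^ sint T * y12 ^ eint T * y2 ^ yint T"

definition M_weight :: "'a \<Rightarrow> 'a \<Rightarrow> 'a \<Rightarrow> 'a \<Rightarrow> 'a \<Rightarrow> plane_tree \<Rightarrow> 'a::comm_ring_1" where
  "M_weight u1 u2 u3 v1 v2 T =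
     u1 ^ sleaf T * u2 ^ etleaf T * u3 ^ entleaf T * v1 ^ yerleaf T * v2 ^ syleaf T"

text \<open>The first child decides the kind of the root: a lone leaf gives
  \<open>x11 * y11\<close>, a leaf with siblings gives \<open>x12 * y12\<close>, and otherwise the
  root is young interior and pays \<open>y2\<close>.\<close>

lemma G_weight_Node:
  fixes x11 x12 x2 y11 y12 y2 :: "'a::comm_ring_1"
  defines "W \<equiv> G_weight x11 x12 x2 y11 y12 y2"
  shows "W (Node (t # ts)) =
    (if t = Node [] then if ts = [] then x11 * y11 else x12 * y12 else y2 * W t)
      * prod_list (map (leaf_or x2 W) ts)"
proof -
  define g where "g = (\<lambda>T v. (if singleton_leaf T v then x11 else 1) *
    (if elder_leaf T v then x12 else 1) * (if young_leaf T v then x2 else 1))"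
  define h where "h = (\<lambda>T v. (if parent_of_singleton_leaf T v then y11 else 1) *
    (if parent_of_elder_leaf T v then y12 else 1) * (if young_interior T v then y2 else 1))"
  have W: "W T = (\<Prod>v\<in>vertices T. g T v * h T v)" for T
    unfolding W_def G_weight_def g_def h_def sleaf_def eleaf_def yleaf_def sint_def eint_def
      yint_def power_card_filter[OF finite_vertices] prod.distrib
    by (simp only: ac_simps)
  have "W (Node (t # ts)) = h (Node (t # ts)) [] *
    (\<Prod>i<length (t # ts). if (t # ts) ! i = Node [] then g (Node (t # ts)) [i]
       else W ((t # ts) ! i))"
    unfolding W
  proof (rule prod_leaf_interior_Node)
    show "g T v = 1" if "\<not> leaf T v" for T v
      using that leaf_kinds_leafD by (auto simp: g_def)
    show "h T v = 1" if "leaf T v" for T v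
      using that by (simp add: h_def interior_kinds_leafD)
  qed (simp_all add: g_def h_def leaf_kinds_Cons interior_kinds_Cons)
  also have "\<dots> = h (Node (t # ts)) [] *
    ((if t = Node [] then g (Node (t # ts)) [0] else W t) *
     (\<Prod>i<length ts. if ts ! i = Node [] then g (Node (t # ts)) [Suc i] else W (ts ! i)))"
    by (simp only: length_Cons prod.lessThan_Suc_shift nth_Cons_0 nth_Cons_Suc)
  \<comment> \<open>A leaf at position \<open>Suc i\<close> has siblings and is not leftmost, hence
    is a young leaf.\<close>
  also have "(\<Prod>i<length ts. if ts ! i = Node [] then g (Node (t # ts)) [Suc i] else W (ts ! i))
    = (\<Prod>i<length ts. leaf_or x2 W (ts ! i))"
    by (rule prod.cong) (auto simp: g_def leaf_or_def leaf_kinds_single)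
  also have "\<dots> = prod_list (map (leaf_or x2 W) ts)"
    by (rule prod_nth_eq_prod_list)
  finally show ?thesis
    by (auto simp: g_def h_def leaf_kinds_single young_interior_def interior_kinds_Nil
        interior_Nil ac_simps)
qed

text \<open>A second child that is a leaf makes the first an elder twin leaf, so \<open>u2\<close>
  and \<open>v2\<close> always occur together as the product \<open>u2 * v2\<close>. From the third
  child on, a leaf is a younger leaf.\<close>

lemma M_weight_Node:
  fixes u1 u2 u3 v1 v2 :: "'a::comm_ring_1"
  defines "W \<equiv> M_weight u1 u2 u3 v1 v2"
  shows "W (Node [Node []]) = u1"
    and "W (Node (Node [] # t # ts)) = (if t = Node [] then u2 * v2 else u3 * W t)
      * prod_list (map (leaf_or v1 W) ts)"
proof -
  define g where "g = (\<lambda>T v. (if singleton_leaf T v then u1 else 1) *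
    (if elder_twin_leaf T v then u2 else 1) * (if elder_nontwin_leaf T v then u3 else 1) *
    (if younger_leaf T v then v1 else 1) * (if second_leaf T v then v2 else 1))"
  \<comment> \<open>The factor 1 stands for \<open>h\<close> in
    \<open>prod_leaf_interior_Node\<close>: these statistics count leaves only.\<close>
  have W: "W T = (\<Prod>v\<in>vertices T. g T v * 1)" for T
    unfolding W_def M_weight_def g_def sleaf_def etleaf_def entleaf_def yerleaf_def
      syleaf_def power_card_filter[OF finite_vertices] prod.distrib
    by simp
  have Node: "W (Node ts) = 1 *
    (\<Prod>i<length ts. if ts ! i = Node [] then g (Node ts) [i] else W (ts ! i))"
    if "ts \<noteq> []" for ts
    unfolding W
  proof (rule prod_leaf_interior_Node)
    show "g T v = 1" if "\<not> leaf T v" for T v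
      using that leaf_kinds_leafD by (auto simp: g_def)
  qed (use that in \<open>simp_all add: g_def leaf_kinds_Cons\<close>)
  show "W (Node [Node []]) = u1"
    by (subst Node) (simp_all add: g_def leaf_kinds_single)
  let ?T = "Node (Node [] # t # ts)"
  have "W ?T = g ?T [0] * ((if t = Node [] then g ?T [1] else W t) *
     (\<Prod>i<length ts. if ts ! i = Node [] then g ?T [Suc (Suc i)] else W (ts ! i)))"
    by (subst Node) (simp_all only: length_Cons prod.lessThan_Suc_shift nth_Cons_0 nth_Cons_Suc
        One_nat_def mult_1 if_True refl list.distinct simp_thms)
  also have "(\<Prod>i<length ts. if ts ! i = Node [] then g ?T [Suc (Suc i)] else W (ts ! i))
    = (\<Prod>i<length ts. leaf_or v1 W (ts ! i))"
    by (rule prod.cong) (auto simp: g_def leaf_or_def leaf_kinds_single)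
  also have "\<dots> = prod_list (map (leaf_or v1 W) ts)"
    by (rule prod_nth_eq_prod_list)
  finally show "W ?T = (if t = Node [] then u2 * v2 else u3 * W t)
      * prod_list (map (leaf_or v1 W) ts)"
    by (simp add: g_def leaf_kinds_single ac_simps)
qed

section \<open>Tip-augmented trees at the root\<close>

lemma tip_augmented_leaf: "tip_augmented (Node [])"
  by (auto simp: tip_augmented_def interior_def vertices_Node)

lemma tip_augmented_Node:
  "tip_augmented (Node (t # ts)) \<longleftrightarrow> t = Node [] \<and> (\<forall>u\<in>set ts. tip_augmented u)"
proof
  assume tip: "tip_augmented (Node (t # ts))"
  then have "leaf (Node (t # ts)) ([] @ [0])"
    unfolding tip_augmented_def using interior_Nil by blast
  moreover have "tip_augmented u" if u: "u \<in> set ts" for u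
  proof -
    from u obtain i where i: "i < length ts" "u = ts ! i"
      by (auto simp: in_set_conv_nth)
    show ?thesis
      unfolding tip_augmented_def
    proof (intro allI impI)
      fix v assume "interior u v"
      \<comment> \<open>The subtree \<open>ts ! i\<close> hangs at position \<open>Suc i\<close>,
        after the first child \<open>t\<close>.\<close>
      then have "leaf (Node (t # ts)) ((Suc i # v) @ [0])"
        using i tip unfolding tip_augmented_def by (simp add: interior_Cons del: append_Cons)
      then show "leaf u (v @ [0])"
        using i by (simp add: leaf_Cons)
    qed
  qed
  ultimately show "t = Node [] \<and> (\<forall>u\<in>set ts. tip_augmented u)"
    by (simp add: leaf_single)
next
  assume *: "t = Node [] \<and> (\<forall>u\<in>set ts. tip_augmented u)"
  show "tip_augmented (Node (t # ts))"
    unfolding tip_augmented_def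
  proof (intro allI impI)
    fix v assume v: "interior (Node (t # ts)) v"
    show "leaf (Node (t # ts)) (v @ [0])"
    proof (cases v)
      case Nil
      then show ?thesis using * by (simp add: leaf_single)
    next
      case (Cons i w)
      with v have i: "i < length (t # ts)"
        by (auto simp: interior_def)
      then have "tip_augmented ((t # ts) ! i)"
        using * nth_mem[OF i] tip_augmented_leaf by auto
      then show ?thesis
        using v i unfolding Cons by (simp add: tip_augmented_def interior_Cons leaf_Cons)
    qed
  qed
qed

section \<open>Generating functions over plane trees\<close>

definition tree_gf :: "(plane_tree \<Rightarrow> 'a::comm_ring_1) \<Rightarrow> 'a fps" where
  "tree_gf f = Abs_fps (\<lambda>n. \<Sum>T\<in>plane_trees n. f T)"

lemma tree_gf_add: "tree_gf (\<lambda>T. f T + g T) = tree_gf f + tree_gf g"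
  by (simp add: tree_gf_def fps_eq_iff sum.distrib)

lemma tree_gf_cmult: "tree_gf (\<lambda>T. c * f T) = fps_const c * tree_gf f"
  by (simp add: tree_gf_def fps_eq_iff sum_distrib_left)

lemma plane_trees_0: "plane_trees 0 = {Node []}"
proof -
  have "T = Node []" if "edges T = 0" for T
    using that by (cases T, cases "children T") auto
  then show ?thesis by (auto simp: plane_trees_def)
qed

text \<open>Cutting the edge from the root to its first child leaves the subtree \<open>t\<close>
  there and the rest \<open>s\<close> of the tree; the cut edge accounts for the
  \<open>Suc\<close>.\<close>

lemma plane_trees_Suc:
  "plane_trees (Suc n) = (\<lambda>(t, s). Node (t # children s)) `
     (\<Union>i\<le>n. plane_trees i \<times> plane_trees (n - i))"
proof (intro set_eqI iffI)
  fix T assume T: "T \<in> plane_trees (Suc n)"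
  then obtain t ts where "T = Node (t # ts)"
    by (cases T, cases "children T") (auto simp: plane_trees_def)
  with T show "T \<in> (\<lambda>(t, s). Node (t # children s)) `
      (\<Union>i\<le>n. plane_trees i \<times> plane_trees (n - i))"
    by (auto simp: plane_trees_def intro!: image_eqI[of _ _ "(t, Node ts)"])
next
  fix T assume "T \<in> (\<lambda>(t, s). Node (t # children s)) `
      (\<Union>i\<le>n. plane_trees i \<times> plane_trees (n - i))"
  then obtain t s where "T = Node (t # children s)" "edges t + edges s = n"
    by (auto simp: plane_trees_def)
  then show "T \<in> plane_trees (Suc n)"
    by (cases s) (simp add: plane_trees_def)
qed

text \<open>Cutting off the first subtree is a bijection, so a weight that factors along it has a
  Cauchy product as its series; \<open>fps_X\<close> marks the cut edge and the constant term is the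
  edgeless tree.\<close>

lemma tree_gf_Node:
  assumes "\<And>t ts. f (Node (t # ts)) = g t * h (Node ts)"
  shows "tree_gf f = fps_const (f (Node [])) + fps_X * (tree_gf g * tree_gf h)"
proof (rule fps_ext)
  fix n
  show "fps_nth (tree_gf f) n
    = fps_nth (fps_const (f (Node [])) + fps_X * (tree_gf g * tree_gf h)) n"
  proof (cases n)
    case 0
    then show ?thesis by (simp add: tree_gf_def plane_trees_0)
  next
    case (Suc m)
    have inj: "inj_on (\<lambda>p. Node (fst p # children (snd p))) A" for A
      by (auto simp: inj_on_def intro: plane_tree.expand)
    have fs: "f (Node (t # children s)) = g t * h s" for t s
      by (simp add: assms)
    have "fps_nth (tree_gf f) n =
        (\<Sum>(t, s)\<in>(\<Union>i\<le>m. plane_trees i \<times> plane_trees (m - i)). g t * h s)"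
      by (simp add: Suc tree_gf_def plane_trees_Suc sum.reindex[OF inj] case_prod_unfold fs)
    also have "\<dots> = (\<Sum>i\<le>m. \<Sum>(t, s)\<in>plane_trees i \<times> plane_trees (m - i). g t * h s)"
      \<comment> \<open>The pieces are disjoint because \<open>i\<close> is the number of edges of
        \<open>t\<close>.\<close>
      by (rule sum.UNION_disjoint) (auto simp: finite_plane_trees, auto simp: plane_trees_def)
    also have "\<dots> = (\<Sum>i\<le>m. (\<Sum>t\<in>plane_trees i. g t) * (\<Sum>s\<in>plane_trees (m - i). h s))"
      by (simp add: sum_product sum.cartesian_product)
    also have "\<dots> = fps_nth (tree_gf g * tree_gf h) m"
      by (simp add: fps_mult_nth tree_gf_def atLeast0AtMost)
    finally show ?thesis by (simp add: Suc)
  qed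
qed

lemma tree_gf_leaf: "tree_gf (leaf_or c (\<lambda>_. 0)) = fps_const (c :: 'a::comm_ring_1)"
proof -
  have "tree_gf (\<lambda>_. 0) = (0 :: 'a fps)"
    by (simp add: tree_gf_def fps_eq_iff)
  then show ?thesis
    by (subst tree_gf_Node[where g = "\<lambda>_. 0" and h = "\<lambda>_. 0"]) (simp_all add: leaf_or_def)
qed

lemma tree_gf_leaf_or: "tree_gf (leaf_or c f) = fps_const c + tree_gf (leaf_or 0 f)"
proof -
  have "leaf_or c f = (\<lambda>T. leaf_or c (\<lambda>_. 0) T + leaf_or 0 f T)"
    by (auto simp: leaf_or_def)
  then show ?thesis
    by (metis tree_gf_add tree_gf_leaf)
qed

text \<open>A forest is empty or a first tree followed by a forest: this is the geometric series in
  \<open>fps_X * tree_gf f\<close>.\<close>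

lemma tree_gf_forest_weight:
  "tree_gf (forest_weight f) = 1 + fps_X * (tree_gf f * tree_gf (forest_weight f))"
  by (subst tree_gf_Node[where g = f and h = "forest_weight f"]) (simp_all add: forest_weight_def)

text \<open>The difference \<open>D\<close> of two solutions is \<open>fps_X\<close> times a
  multiple of itself, so each of its coefficients is determined by earlier ones and all vanish. No
  cancellation is involved, so zero divisors do no harm.\<close>

lemma fps_quadratic_unique:
  fixes F M A B :: "'a::comm_ring_1 fps"
  assumes F: "F = A + fps_X * (B * F + F * F)" and M: "M = A + fps_X * (B * M + M * M)"
  shows "F = M"
proof -
  define D where "D = F - M"
  have D: "D = fps_X * ((B + F + M) * D)"
    using arg_cong2[where f = minus, OF F M] by (simp add: D_def algebra_simps)
  have "fps_nth D n = 0" for n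
  proof (induction n rule: less_induct)
    case (less n)
    \<comment> \<open>Coefficient \<open>m\<close> involves only coefficients of \<open>D\<close> of
      index at most \<open>m\<close>, which is below \<open>n\<close>.\<close>
    have "fps_nth ((B + F + M) * D) m = 0" if "n = Suc m" for m
      unfolding fps_mult_nth by (rule sum.neutral) (simp add: that less.IH)
    then show ?case
      by (subst D) (cases n; simp)
  qed
  then show ?thesis
    by (simp add: D_def fps_eq_iff)
qed

section \<open>Quadratic equations for the two generating functions\<close>

lemma G_gf_equation:
  fixes x11 x12 x2 y11 y12 y2 :: "'a::comm_ring_1"
  defines "a \<equiv> fps_const (x11 * y11)" and "b \<equiv> fps_const (x12 * y12)"
    and "x \<equiv> fps_const x2" and "y \<equiv> fps_const y2"
    and "F \<equiv> tree_gf (leaf_or 0 (G_weight x11 x12 x2 y11 y12 y2))"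
  shows "F = fps_X * a + fps_X * fps_X * ((b - a) * x)
    + fps_X * ((x + y + fps_X * (b - a)) * F + F * F)"
proof -
  define W where "W = G_weight x11 x12 x2 y11 y12 y2"
  define S where "S = tree_gf (forest_weight (leaf_or x2 W))"
  let ?l = "leaf_or (1::'a) (\<lambda>_. 0)"
  let ?Q = "forest_weight (leaf_or x2 W)"
  \<comment> \<open>One summand for each kind of root: parent of a singleton leaf, parent of an
    elder leaf, young interior. The factor \<open>?l t\<close> forces a leaf as first child; the
    factor on \<open>Node ts\<close> forces \<open>ts\<close> to be empty in \<open>?f1\<close> and
    nonempty in \<open>?f2\<close>.\<close>
  let ?f1 = "\<lambda>T. case children T of [] \<Rightarrow> 0 | t # ts \<Rightarrow> ?l t * leaf_or (x11 * y11) (\<lambda>T. 0) (Node ts)"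
  let ?f2 = "\<lambda>T. case children T of [] \<Rightarrow> 0 | t # ts \<Rightarrow> ?l t * (x12 * y12 * leaf_or 0 ?Q (Node ts))"
  let ?f3 = "\<lambda>T. case children T of [] \<Rightarrow> 0 | t # ts \<Rightarrow> y2 * leaf_or 0 W t * ?Q (Node ts)"
  \<comment> \<open>The empty forest has weight 1, so nonempty forests have the series
    \<open>S - 1\<close>.\<close>
  have Q1: "leaf_or 1 ?Q = ?Q"
    by (auto simp: fun_eq_iff leaf_or_def forest_weight_def)
  have "leaf_or 0 W T = ?f1 T + ?f2 T + ?f3 T" for T
    by (cases T rule: plane_tree.exhaust, rename_tac us, case_tac us)
       (auto simp: leaf_or_def forest_weight_def W_def G_weight_Node)
  then have "F = tree_gf (\<lambda>T. ?f1 T + ?f2 T + ?f3 T)"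
    unfolding F_def W_def[symmetric] by (rule arg_cong[OF ext, where f = tree_gf])
  also have "\<dots> = tree_gf ?f1 + tree_gf ?f2 + tree_gf ?f3"
    by (simp only: tree_gf_add)
  also have "tree_gf ?f1 = fps_X * a"
    by (subst tree_gf_Node[where g = ?l and h = "leaf_or (x11 * y11) (\<lambda>T. 0)"])
       (simp_all add: tree_gf_leaf a_def)
  also have "tree_gf ?f2 = fps_X * (b * (S - 1))"
    using tree_gf_leaf_or[of 1 ?Q] unfolding Q1
    by (subst tree_gf_Node[where g = ?l and h = "\<lambda>T. x12 * y12 * leaf_or 0 ?Q T"])
       (simp_all add: tree_gf_leaf tree_gf_cmult b_def S_def)
  also have "tree_gf ?f3 = fps_X * (y * F * S)"
    by (subst tree_gf_Node[where g = "\<lambda>T. y2 * leaf_or 0 W T" and h = ?Q])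
       (simp_all add: tree_gf_cmult y_def F_def S_def W_def)
  finally have F: "F = fps_X * a + fps_X * (b * (S - 1)) + fps_X * (y * F * S)" .
  have S: "S = 1 + fps_X * ((x + F) * S)"
    using tree_gf_forest_weight[of "leaf_or x2 W"] tree_gf_leaf_or[of x2 W]
    by (simp add: S_def x_def F_def W_def)
  show ?thesis
  proof -
    define p where "p = fps_X * (x + F)"
    have S': "S * (1 - p) = 1"
      using S by (simp add: p_def algebra_simps)
    \<comment> \<open>Multiplying the equation for \<open>F\<close> by \<open>1 - p\<close> makes
      \<open>S\<close> occur only in \<open>S * (1 - p)\<close>, which is 1; this eliminates
      \<open>S\<close> without division.\<close>
    have "F = F * (1 - p) + F * p"
      by (simp add: algebra_simps)
    also have "F * (1 - p) = fps_X * a * (1 - p) + fps_X * b * (S * (1 - p) - (1 - p))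
        + fps_X * y * F * (S * (1 - p))"
      using arg_cong[OF F, of "\<lambda>u. u * (1 - p)"] by (simp add: algebra_simps)
    finally show ?thesis
      unfolding S' by (simp add: p_def algebra_simps)
  qed
qed

text \<open>Extending the weight by zero to trees that are not tip-augmented lets the sums run over
  all plane trees. The first child being a leaf, the second is split off next, and the others form a
  forest with series \<open>S\<close>.\<close>

lemma M_gf_equation:
  fixes u1 u2 u3 v1 v2 :: "'a::comm_ring_1"
  defines "a \<equiv> fps_const u1" and "b \<equiv> fps_const u3"
    and "c \<equiv> fps_const (u2 * v2)" and "d \<equiv> fps_const v1"
    and "M \<equiv> tree_gf (leaf_or 0 (\<lambda>T. if tip_augmented T then M_weight u1 u2 u3 v1 v2 T else 0))"
  shows "M = fps_X * a + fps_X * fps_X * (c - a * d)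
    + fps_X * ((d + fps_X * (b - a)) * M + M * M)"
proof -
  define W where "W = (\<lambda>T. if tip_augmented T then M_weight u1 u2 u3 v1 v2 T else 0)"
  let ?Q = "forest_weight (leaf_or v1 W)"
  define S where "S = tree_gf ?Q"
  let ?l = "leaf_or (1::'a) (\<lambda>_. 0)"
  \<comment> \<open>\<open>?k\<close> is the joint contribution of the first two children, and
    \<open>?B\<close> that of all children, as a function of the tree left after cutting off the
    first leaf. The value \<open>u1\<close> of \<open>?B\<close> is the case of a lone leaf.\<close>
  let ?k = "\<lambda>T. leaf_or (u2 * v2) (\<lambda>_. 0) T + u3 * leaf_or 0 W T"
  let ?B = "\<lambda>T. case children T of [] \<Rightarrow> u1 | t # ts \<Rightarrow> ?k t * ?Q (Node ts)"
  \<comment> \<open>One subtree that is not tip-augmented makes the whole product vanish.\<close>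
  have Q: "prod_list (map (leaf_or v1 W) ts) =
      (if \<forall>u\<in>set ts. tip_augmented u
       then prod_list (map (leaf_or v1 (M_weight u1 u2 u3 v1 v2)) ts) else 0)" for ts
    by (induction ts) (auto simp: leaf_or_def[abs_def] W_def tip_augmented_leaf)
  have W_apply: "W T = (if tip_augmented T then M_weight u1 u2 u3 v1 v2 T else 0)" for T
    by (simp add: W_def)
  have W_Node: "leaf_or 0 W (Node (t # ts)) = ?l t * ?B (Node ts)" for t ts
    by (cases ts)
       (auto simp: W_apply leaf_or_def forest_weight_def Q M_weight_Node tip_augmented_Node
         tip_augmented_leaf)
  have "M = fps_X * tree_gf ?B"
    unfolding M_def W_def[symmetric]
    by (subst tree_gf_Node[where g = ?l and h = ?B, OF W_Node])
       (simp_all add: tree_gf_leaf leaf_or_def[of _ _ "Node []"])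
  also have "tree_gf ?B = a + fps_X * ((c + b * M) * S)"
    by (subst tree_gf_Node[where g = ?k and h = ?Q])
       (simp_all add: tree_gf_add tree_gf_cmult tree_gf_leaf a_def b_def c_def S_def M_def W_def)
  finally have M: "M = fps_X * (a + fps_X * ((c + b * M) * S))" .
  have S: "S = 1 + fps_X * ((d + M) * S)"
    using tree_gf_forest_weight[of "leaf_or v1 W"] tree_gf_leaf_or[of v1 W]
    by (simp add: S_def d_def M_def W_def)
  show ?thesis
  proof -
    define p where "p = fps_X * (d + M)"
    have S': "S * (1 - p) = 1"
      using S by (simp add: p_def algebra_simps)
    have "M = M * (1 - p) + M * p"
      by (simp add: algebra_simps)
    also have "M * (1 - p) = fps_X * a * (1 - p) + fps_X * fps_X * (c + b * M) * (S * (1 - p))"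
      using arg_cong[OF M, of "\<lambda>u. u * (1 - p)"] by (simp add: algebra_simps)
    finally show ?thesis
      unfolding S' by (simp add: p_def algebra_simps)
  qed
qed

theorem theorem1p20:
  fixes n :: nat
    and x11 x12 x2 y11 y12 y2 u1 u2 u3 v1 v2 :: "'a::comm_ring_1"
  assumes "n \<ge> 1"
    and "u1 = x11 * y11"
    and "u3 = x12 * y12"
    and "v1 = x2 + y2"
    and "u2 * v2 = x12 * y12 * x2 + x11 * y11 * y2"
  shows "G_poly (n + 1) x11 x12 x2 y11 y12 y2 = M_poly n u1 u2 u3 v1 v2"
proof -
  define F where "F = tree_gf (leaf_or 0 (G_weight x11 x12 x2 y11 y12 y2))"
  define W where "W = (\<lambda>T. if tip_augmented T then M_weight u1 u2 u3 v1 v2 T else 0)"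
  define M where "M = tree_gf (leaf_or 0 W)"
  define a b x y where "a = fps_const (x11 * y11)" and "b = fps_const (x12 * y12)"
    and "x = fps_const x2" and "y = fps_const y2"
  have F: "F = (fps_X * a + fps_X * fps_X * ((b - a) * x))
    + fps_X * ((x + y + fps_X * (b - a)) * F + F * F)"
    unfolding F_def a_def b_def x_def y_def by (rule G_gf_equation)
  \<comment> \<open>This matches the inhomogeneous terms of the two equations, and is where the
    prescribed value of \<open>u2 * v2\<close> enters.\<close>
  have "b * x + a * y - a * (x + y) = (b - a) * x"
    by (simp add: algebra_simps)
  moreover have "fps_const u1 = a" "fps_const u3 = b" "fps_const v1 = x + y"
    "fps_const (u2 * v2) = b * x + a * y"
    unfolding assms(2-5) by (simp_all add: a_def b_def x_def y_def)
  ultimately have M: "M = (fps_X * a + fps_X * fps_X * ((b - a) * x))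
    + fps_X * ((x + y + fps_X * (b - a)) * M + M * M)"
    using M_gf_equation[of u1 u2 u3 v1 v2] by (simp only: M_def W_def)
  \<comment> \<open>In degree \<open>n + 1\<close> there is no edgeless tree, so
    \<open>leaf_or 0\<close> leaves the coefficient unchanged.\<close>
  have no_leaf: "Node [] \<notin> plane_trees (Suc n)"
    by (simp add: plane_trees_def)
  have "G_poly (n + 1) x11 x12 x2 y11 y12 y2 = fps_nth F (n + 1)"
    unfolding G_poly_def F_def tree_gf_def fps_nth_Abs_fps
    by (rule sum.cong) (auto simp: leaf_or_def G_weight_def no_leaf)
  also have "F = M"
    using F M by (rule fps_quadratic_unique)
  also have "fps_nth M (n + 1) = (\<Sum>T\<in>plane_trees (n + 1). W T)"
    unfolding M_def tree_gf_def fps_nth_Abs_fps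
    by (rule sum.cong) (auto simp: leaf_or_def no_leaf)
  also have "\<dots> = (\<Sum>T\<in>{T \<in> plane_trees (n + 1). tip_augmented T}. M_weight u1 u2 u3 v1 v2 T)"
    by (simp add: W_def sum.inter_filter[OF finite_plane_trees])
  also have "{T \<in> plane_trees (n + 1). tip_augmented T} = tip_augmented_trees (n + 1)"
    by (auto simp: plane_trees_def tip_augmented_trees_def)
  finally show ?thesis
    by (simp add: M_poly_def M_weight_def)
qed

end
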